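(* Let $p\in\mathbb{N}$, let $\mathbf{a}=(a_1,\dots,a_p)$, $\mathbf{b}=(b_1,\dots,b_p)$ be complex vectors, and let $g^p_p(n)$ be Nørlund's coefficients defined in the context. With $\psi_m=\sum_{j=1}^m(b_j-a_j)$, the first four coefficients are $$g^{p}_{p}(0)=1,\qquad g^{p}_{p}(1)=\sum_{m=1}^{p-1}(b_{m+1}-a_m)\psi_m,$$ $$g^{p}_{p}(2)=\frac{1}{2}\sum_{m=1}^{p-1}(b_{m+1}-a_m)_2(\psi_m)_2+\sum_{k=2}^{p-1}(b_{k+1}-a_{k})(\psi_{k}+1)\sum_{m=1}^{k-1}(b_{m+1}-a_m)\psi_m,$$ and $$\begin{aligned}g^{p}_{p}(3)={}&\frac{1}{6}\sum_{m=1}^{p-1}(b_{m+1}-a_m)_3(\psi_m)_3+\frac{1}{2}\sum_{k=2}^{p-1}(b_{k+1}-a_{k})(\psi_{k}+2)\sum_{m=1}^{k-1}(b_{m+1}-a_m)_2(\psi_m)_2\\&+\frac{1}{2}\sum_{k=2}^{p-1}(\psi_{k}+1)_2(b_{k+1}-a_{k})_2\sum_{m=1}^{k-1}(b_{m+1}-a_m)\psi_m\\&+\sum_{n=3}^{p-1}(b_{n+1}-a_n)(\psi_n+2)\sum_{k=2}^{n-1}(b_{k+1}-a_{k})(\psi_{k}+1)\sum_{m=1}^{k-1}(b_{m+1}-a_m)\psi_m.\end{aligned}$$ (Empty sums are zero.)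
   Context: Notation: $(x)_n=x(x+1)\cdots(x+n-1)$, $(x)_0=1$, is the rising factorial; $\mathbb{N}_0=\{0,1,2,\dots\}$; $\psi_m=\sum_{i=1}^m(b_i-a_i)$. Meijer's function $G^{p,0}_{p,p}$: for $0<z<1$, $$G^{p,0}_{p,p}\left(z\,\Big|\,{\mathbf{b}\atop\mathbf{a}}\right)=\frac{1}{2\pi i}\int_{\mathcal{L}_-}\frac{\Gamma(a_1+s)\cdots\Gamma(a_p+s)}{\Gamma(b_1+s)\cdots\Gamma(b_p+s)}z^{-s}\,ds,$$ where $\mathcal{L}_-$ is a left loop lying in a horizontal strip, starting at $-\infty+i\varphi_1$, ending at $-\infty+i\varphi_2$ ($\varphi_1<\varphi_2$), and having all poles of the integrand on its left. Nørlund's coefficients $g^k_p(n)$, $k\in\{1,\dots,p\}$, $n\in\mathbb{N}_0$, are defined (for $-\psi_p\notin\mathbb{N}_0$) by the expansion, for $0<z<1$, $$G^{p,0}_{p,p}\left(z\,\Big|\,{\mathbf{b}\atop\mathbf{a}}\right)=\frac{z^{a_k}(1-z)^{\psi_p-1}}{\Gamma(\psi_p)}\sum_{n=0}^{\infty}\frac{g_p^k(n)}{(\psi_p)_n}(1-z)^n.$$ They are polynomials in the components of $\mathbf{a}$ and $\mathbf{b}$ (which defines them for all complex parameters). By a known formula of Nørlund they are given explicitly by $$g^{p}_{p}(n)=\sum_{0\le j_1\le j_2\le\cdots\le j_{p-2}\le n}\ \prod_{m=1}^{p-1}\frac{(\psi_m+j_{m-1})_{j_m-j_{m-1}}}{(j_m-j_{m-1})!}(b_{m+1}-a_m)_{j_m-j_{m-1}},\qquad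 j_0=0,\ j_{p-1}=n,$$ (for $p=1$: $g^1_1(0)=1$ and $g^1_1(n)=0$ for $n\ge1$), and $g^k_p(n)$ is obtained from $g^p_p(n)$ by exchanging the roles of $a_p$ and $a_k$. *)

theory Defs
  imports "HOL-Complex_Analysis.Complex_Analysis"
begin

text \<open>
  Parameter vectors \<open>(a\<^sub>1, \<dots>, a\<^sub>p)\<close> are functions \<^typ>\<open>nat \<Rightarrow> complex\<close>
  of which only the values at \<open>1, \<dots>, p\<close> are relevant.
\<close>

definition psi :: "(nat \<Rightarrow> complex) \<Rightarrow> (nat \<Rightarrow> complex) \<Rightarrow> nat \<Rightarrow> complex" where
  "psi a b m = (\<Sum>i=1..m. b i - a i)"

definition meijer_integrand ::
    "nat \<Rightarrow> (nat \<Rightarrow> complex) \<Rightarrow> (nat \<Rightarrow> complex) \<Rightarrow> real \<Rightarrow> complex \<Rightarrow> complex" where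
  "meijer_integrand p a b z s =
     (\<Prod>i=1..p. Gamma (a i + s)) * (\<Prod>i=1..p. rGamma (b i + s)) * of_real z powr (- s)"

text \<open>
  The left loop is rectangular: from \<open>-\<infinity> + i\<phi>\<^sub>1\<close> horizontally to \<open>c + i\<phi>\<^sub>1\<close>, vertically up to
  \<open>c + i\<phi>\<^sub>2\<close>, and horizontally back to \<open>-\<infinity> + i\<phi>\<^sub>2\<close>. It is cut off at real part \<open>-R\<close>,
  and integrals along it are limits for \<open>R \<rightarrow> \<infinity>\<close>. All points \<open>- a\<^sub>i - n\<close> lie to its left
  iff the points \<open>- a\<^sub>i\<close> do.
\<close>

definition truncated_left_loop :: "real \<Rightarrow> real \<Rightarrow> real \<Rightarrow> real \<Rightarrow> real \<Rightarrow> complex" where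
  "truncated_left_loop c \<phi>1 \<phi>2 R =
     linepath (Complex (- R) \<phi>1) (Complex c \<phi>1) +++
     linepath (Complex c \<phi>1) (Complex c \<phi>2) +++
     linepath (Complex c \<phi>2) (Complex (- R) \<phi>2)"

definition admissible_left_loop ::
    "nat \<Rightarrow> (nat \<Rightarrow> complex) \<Rightarrow> real \<Rightarrow> real \<Rightarrow> real \<Rightarrow> bool" where
  "admissible_left_loop p a c \<phi>1 \<phi>2 \<longleftrightarrow> \<phi>1 < \<phi>2 \<and>
     (\<forall>i\<in>{1..p}. Re (- a i) < c \<and> \<phi>1 < Im (- a i) \<and> Im (- a i) < \<phi>2)"

text \<open>
  Meijer's function \<open>G\<close> with upper indices \<open>p, 0\<close> and lower indices \<open>p, p\<close>, for \<open>0 < z < 1\<close>.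
  The value does not depend on the choice of the loop.
\<close>

definition meijer_G :: "nat \<Rightarrow> (nat \<Rightarrow> complex) \<Rightarrow> (nat \<Rightarrow> complex) \<Rightarrow> real \<Rightarrow> complex" where
  "meijer_G p a b z = (THE w. \<forall>c \<phi>1 \<phi>2. admissible_left_loop p a c \<phi>1 \<phi>2 \<longrightarrow>
     ((\<lambda>R. 1 / (2 * of_real pi * \<i>) *
        contour_integral (truncated_left_loop c \<phi>1 \<phi>2 R) (meijer_integrand p a b z))
      \<longlongrightarrow> w) at_top)"

text \<open>Polynomial functions of the components \<open>a\<^sub>1, \<dots>, a\<^sub>p, b\<^sub>1, \<dots>, b\<^sub>p\<close>.\<close>

inductive polynomial_in_params ::
    "nat \<Rightarrow> ((nat \<Rightarrow> complex) \<Rightarrow> (nat \<Rightarrow> complex) \<Rightarrow> complex) \<Rightarrow> bool" for p where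
  const: "polynomial_in_params p (\<lambda>a b. c)"
| comp_a: "i \<in> {1..p} \<Longrightarrow> polynomial_in_params p (\<lambda>a b. a i)"
| comp_b: "i \<in> {1..p} \<Longrightarrow> polynomial_in_params p (\<lambda>a b. b i)"
| add: "polynomial_in_params p f \<Longrightarrow> polynomial_in_params p h \<Longrightarrow>
        polynomial_in_params p (\<lambda>a b. f a b + h a b)"
| mult: "polynomial_in_params p f \<Longrightarrow> polynomial_in_params p h \<Longrightarrow>
         polynomial_in_params p (\<lambda>a b. f a b * h a b)"

text \<open>
  \<open>norlund_coefficients p k g\<close>: \<open>g a b n\<close> is the Norlund coefficient with upper index \<open>k\<close>
  and lower index \<open>p\<close>. For \<open>-\<psi>\<^sub>p\<close> not in \<open>\<nat> = {0, 1, 2, \<dots>}\<close> the coefficients are fixed by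
  the expansion of \<open>G\<close> at \<open>z = 1\<close>; polynomial dependence on the parameters then fixes them
  for all complex \<open>a\<close> and \<open>b\<close>.
\<close>

definition norlund_coefficients ::
    "nat \<Rightarrow> nat \<Rightarrow> ((nat \<Rightarrow> complex) \<Rightarrow> (nat \<Rightarrow> complex) \<Rightarrow> nat \<Rightarrow> complex) \<Rightarrow> bool" where
  "norlund_coefficients p k g \<longleftrightarrow>
     (\<forall>n. polynomial_in_params p (\<lambda>a b. g a b n)) \<and>
     (\<forall>a b. - psi a b p \<notin> \<nat> \<longrightarrow>
       (\<forall>z::real. 0 < z \<and> z < 1 \<longrightarrow>
         summable (\<lambda>n. g a b n / pochhammer (psi a b p) n * of_real (1 - z) ^ n) \<and>
         meijer_G p a b z =
           of_real z powr a k * of_real (1 - z) powr (psi a b p - 1) / Gamma (psi a b p) *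
           (\<Sum>n. g a b n / pochhammer (psi a b p) n * of_real (1 - z) ^ n)))"

end

theory Submission
  imports Defs
begin

text \<open>
  Both \<open>g\<close> and the explicit multiple sum are polynomials in the parameters, so it suffices to
  compare them when every \<open>b\<^sub>i - a\<^sub>i\<close> is a positive integer \<open>m\<^sub>i\<close>. There the Gamma quotient is
  the rational function \<open>1 / (\<Prod>c. s + c)\<close>, where \<open>c\<close> runs over the numbers \<open>a\<^sub>i + k\<close> with
  \<open>k < m\<^sub>i\<close>, and the loop can be replaced by a large circle. With \<open>z = 1 - w\<close>, expanding
  \<open>z powr (- s)\<close> in powers of \<open>w\<close> under the integral sign expresses \<open>G\<close> as a power series \<open>F\<close> in
  \<open>w\<close>. Inserting one more factor \<open>s + c\<close> in the denominator replaces \<open>F\<close> by the solution \<open>F'\<close> of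
  \<open>(1 - X) * deriv F' + c * F' = F\<close>. Adding the numbers \<open>a\<^sub>p + k\<close> one at a time, this equation and
  a change of the exponent from \<open>a\<^bsub>p-1\<^esub>\<close> to \<open>a\<^sub>p\<close> give the recursion in \<open>p\<close> behind the explicit
  formula.
\<close>

unbundle no vec_syntax

section \<open>The power series recursion\<close>

text \<open>The power series of \<open>(1 - X) ^ e\<close>.\<close>

definition bin_fps :: "complex \<Rightarrow> complex fps" where
  "bin_fps e = Abs_fps (\<lambda>n. pochhammer (- e) n / fact n)"

lemma bin_fps_0_nth [simp]: "bin_fps e $ 0 = 1"
  by (simp add: bin_fps_def)

lemma bin_fps_nonzero: "bin_fps e \<noteq> 0"
  by (metis bin_fps_0_nth fps_zero_nth zero_neq_one)

text \<open>The Chu-Vandermonde identity for rising factorials, read coefficient by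
  coefficient.\<close>

lemma bin_fps_add: "bin_fps (d + e) = bin_fps d * bin_fps e"
proof (rule fps_ext)
  fix n
  have "pochhammer (- d - e) n / fact n = (\<Sum>i=0..n. pochhammer (- d) i / fact i * (pochhammer (- e) (n - i) / fact (n - i)))"
    using pochhammer_binomial_sum[of "- d" "- e" n]
    by (simp add: sum_divide_distrib binomial_fact field_simps atLeast0AtMost)
  then show "bin_fps (d + e) $ n = (bin_fps d * bin_fps e) $ n"
    by (simp add: bin_fps_def fps_mult_nth)
qed

lemma one_minus_X_deriv_nth:
  fixes F :: "complex fps"
  shows "((1 - fps_X) * fps_deriv F + fps_const c * F) $ n =
    of_nat (Suc n) * F $ Suc n + (c - of_nat n) * F $ n"
proof -
  have "((1 - fps_X) * fps_deriv F) $ n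
      = fps_deriv F $ n - (if n = 0 then 0 else fps_deriv F $ (n - 1))"
    by (simp add: algebra_simps)
  then show ?thesis
    by (cases n) (simp_all add: algebra_simps)
qed

lemma bin_fps_deriv: "(1 - fps_X) * fps_deriv (bin_fps e) + fps_const e * bin_fps e = 0"
proof (rule fps_ext)
  fix n
  show "((1 - fps_X) * fps_deriv (bin_fps e) + fps_const e * bin_fps e) $ n = 0 $ n"
    unfolding one_minus_X_deriv_nth
    by (simp add: bin_fps_def pochhammer_Suc field_simps del: of_nat_Suc)
qed

text \<open>The coefficient of \<open>X^n\<close> in the equation fixes \<open>F $ Suc n\<close> in
  terms of \<open>F $ n\<close>, because \<open>of_nat (Suc n)\<close> is nonzero.\<close>

lemma fps_first_order_ode_unique:
  fixes F G :: "complex fps"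
  assumes "(1 - fps_X) * fps_deriv F + fps_const c * F = (1 - fps_X) * fps_deriv G + fps_const c * G"
    and "F $ 0 = G $ 0"
  shows "F = G"
proof (rule fps_ext)
  show "F $ n = G $ n" for n
  proof (induction n)
    case (Suc n)
    have "((1 - fps_X) * fps_deriv F + fps_const c * F) $ n = ((1 - fps_X) * fps_deriv G + fps_const c * G) $ n"
      by (simp only: assms(1))
    then show ?case
      unfolding one_minus_X_deriv_nth Suc by (simp del: of_nat_Suc)
  qed (fact assms(2))
qed

text \<open>
  \<open>moment cs n\<close> is the value of \<open>1 / (2 \<pi> \<i>)\<close> times the integral of
  \<open>pochhammer s n / (\<Prod>c\<leftarrow>cs. s + c)\<close> over a large circle; the recursion comes from
  \<open>pochhammer s (n + 1) = pochhammer s n * ((s + c) + (n - c))\<close>.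
\<close>

fun moment :: "complex list \<Rightarrow> nat \<Rightarrow> complex" where
  "moment [] n = 0"
| "moment (c # cs) 0 = (if cs = [] then 1 else 0)"
| "moment (c # cs) (Suc n) = moment cs n + (of_nat n - c) * moment (c # cs) n"

text \<open>Since \<open>pochhammer s n / fact n\<close> are the coefficients of
  \<open>(1 - w) powr (- s)\<close>, this expands in \<open>w\<close> the integral of
  \<open>(1 - w) powr (- s) / (\<Prod>c\<leftarrow>cs. s + c)\<close> over a large circle, divided
  by \<open>2 \<pi> \<i>\<close>.\<close>

definition moment_fps :: "complex list \<Rightarrow> complex fps" where
  "moment_fps cs = Abs_fps (\<lambda>n. moment cs n / fact n)"

lemma moment_fps_singleton: "moment_fps [c] = bin_fps c"
proof -
  have "moment [c] n = pochhammer (- c) n" for n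
    by (induction n) (simp_all add: pochhammer_Suc)
  then show ?thesis by (simp add: moment_fps_def bin_fps_def)
qed

text \<open>On \<open>(1 - w) powr (- s)\<close> the operator \<open>(1 - w) d/dw + c\<close> acts
  as multiplication by \<open>s + c\<close>, which cancels the new factor of the
  denominator.\<close>

lemma moment_fps_Cons:
  "(1 - fps_X) * fps_deriv (moment_fps (c # cs)) + fps_const c * moment_fps (c # cs) = moment_fps cs"
proof (rule fps_ext)
  fix n
  show "((1 - fps_X) * fps_deriv (moment_fps (c # cs)) + fps_const c * moment_fps (c # cs)) $ n = moment_fps cs $ n"
    unfolding one_minus_X_deriv_nth
    by (simp add: moment_fps_def field_simps del: of_nat_Suc)
qed

text \<open>
  Since \<open>N! (N + 1)\<^sub>n = (N + n)!\<close>, this is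
  \<open>X\<^sup>N / N!\<close> times the Norlund series with \<open>\<psi>\<^sub>p = N + 1\<close>.
\<close>

definition shifted_fps :: "nat \<Rightarrow> (nat \<Rightarrow> complex) \<Rightarrow> complex fps" where
  "shifted_fps N \<gamma> = fps_X ^ N * Abs_fps (\<lambda>n. \<gamma> n / fact (N + n))"

lemma shifted_fps_nth: "shifted_fps N \<gamma> $ k = (if k < N then 0 else \<gamma> (k - N) / fact k)"
  by (simp add: shifted_fps_def fps_X_power_mult_nth)

lemma shifted_fps_inj: "shifted_fps N \<gamma> = shifted_fps N \<delta> \<Longrightarrow> \<gamma> = \<delta>"
proof
  fix n
  assume "shifted_fps N \<gamma> = shifted_fps N \<delta>"
  then have "shifted_fps N \<gamma> $ (N + n) = shifted_fps N \<delta> $ (N + n)" by simp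
  then show "\<gamma> n = \<delta> n" by (simp add: shifted_fps_nth)
qed

text \<open>For a solution of the form \<open>K * bin_fps e\<close>, the equation of
  \<open>bin_fps e\<close> leaves \<open>(1 - X) * K' + m * K = shifted_fps N \<gamma>\<close>,
  whose coefficients give the recursion for \<delta>. As \<open>cs\<close> is nonempty, both
  constant terms are zero.\<close>

lemma moment_fps_Cons_shifted:
  assumes cs: "moment_fps cs = shifted_fps N \<gamma> * bin_fps e" "cs \<noteq> []"
    and "\<delta> 0 = \<gamma> 0" "\<And>n. \<delta> (Suc n) = \<gamma> (Suc n) + (of_nat N + 1 - m + of_nat n) * \<delta> n"
  shows "moment_fps ((e + m) # cs) = shifted_fps (Suc N) \<delta> * bin_fps e"
proof (rule fps_first_order_ode_unique)
  let ?K = "shifted_fps (Suc N) \<delta>" and ?c = "e + m"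
  have K: "(1 - fps_X) * fps_deriv ?K + fps_const m * ?K = shifted_fps N \<gamma>"
  proof (rule fps_ext)
    fix n
    have nth: "of_nat (Suc n) * ?K $ Suc n = (if n < N then 0 else \<delta> (n - N) / fact n)"
      by (simp add: shifted_fps_nth field_simps del: of_nat_Suc)
    \<comment> \<open>Below \<open>X^N\<close> both sides vanish, at \<open>X^N\<close> the equation
      is \<open>\<delta> 0 = \<gamma> 0\<close>, and beyond it is the recursion for
      \<delta>.\<close>
    consider "n < N" | "n = N" | k where "n = Suc (N + k)"
      by (metis less_imp_Suc_add linorder_neqE_nat)
    then show "((1 - fps_X) * fps_deriv ?K + fps_const m * ?K) $ n = shifted_fps N \<gamma> $ n"
    proof cases
      case 3
      then show ?thesis
        unfolding one_minus_X_deriv_nth nth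
        by (simp add: shifted_fps_nth assms(4) Suc_diff_le add_divide_distrib flip: add_divide_distrib del: fact_Suc)
          (simp add: algebra_simps)
    qed (unfold one_minus_X_deriv_nth nth, auto simp: shifted_fps_nth assms(3))
  qed
  have "(1 - fps_X) * fps_deriv (?K * bin_fps e) + fps_const ?c * (?K * bin_fps e)
      = ((1 - fps_X) * fps_deriv ?K + fps_const m * ?K) * bin_fps e
        + ?K * ((1 - fps_X) * fps_deriv (bin_fps e) + fps_const e * bin_fps e)"
    by (simp add: algebra_simps flip: fps_const_add)
  also have "\<dots> = moment_fps cs"
    by (simp add: K bin_fps_deriv cs)
  finally show "(1 - fps_X) * fps_deriv (moment_fps (?c # cs)) + fps_const ?c * moment_fps (?c # cs) =
      (1 - fps_X) * fps_deriv (?K * bin_fps e) + fps_const ?c * (?K * bin_fps e)"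
    by (simp add: moment_fps_Cons)
  show "moment_fps (?c # cs) $ 0 = (?K * bin_fps e) $ 0"
    using cs(2) by (simp add: moment_fps_def shifted_fps_nth)
qed

section \<open>The step from one parameter pair to the next\<close>

text \<open>One factor of Norlund's multiple sum: \<open>j\<close> and \<open>n\<close> are the
  consecutive indices with numbers \<open>m - 1\<close> and \<open>m\<close>, \<open>x\<close>
  stands for \<open>psi a b m\<close> and \<open>c\<close> for \<open>b (m+1) - a m\<close>.\<close>

definition norlund_step :: "complex \<Rightarrow> complex \<Rightarrow> (nat \<Rightarrow> complex) \<Rightarrow> nat \<Rightarrow> complex" where
  "norlund_step x c \<gamma> n =
     (\<Sum>j\<le>n. pochhammer (x + of_nat j) (n - j) / fact (n - j) * pochhammer c (n - j) * \<gamma> j)"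

lemma norlund_step_0 [simp]: "norlund_step x c \<gamma> 0 = \<gamma> 0"
  by (simp add: norlund_step_def)

text \<open>This is the recursion that \<open>moment_fps_Cons_shifted\<close> asks for, so each
  added root raises \<open>c\<close> by one. With \<open>k = n - j\<close> it comes from
  \<open>pochhammer (c+1) (k+1) = pochhammer c (k+1) + (k+1) * pochhammer (c+1) k\<close>; the term
  \<open>j = n + 1\<close> is the same on both sides.\<close>

lemma norlund_step_Suc:
  "norlund_step x (c + 1) \<gamma> (Suc n) =
     norlund_step x c \<gamma> (Suc n) + (x + of_nat n) * norlund_step x (c + 1) \<gamma> n"
proof -
  have *: "pochhammer (x + of_nat j) (Suc n - j) / fact (Suc n - j) * pochhammer (c + 1) (Suc n - j) * \<gamma> j
     = pochhammer (x + of_nat j) (Suc n - j) / fact (Suc n - j) * pochhammer c (Suc n - j) * \<gamma> j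
      + (x + of_nat n) * (pochhammer (x + of_nat j) (n - j) / fact (n - j) * pochhammer (c + 1) (n - j) * \<gamma> j)"
    if j: "j \<le> n" for j
  proof -
    obtain k where n: "n = j + k" using le_Suc_ex[OF j] by blast
    \<comment> \<open>\<open>P\<close> and \<open>Q\<close> are the rising factorials of length
      \<open>k\<close> of \<open>x + j\<close> and \<open>c + 1\<close>; \<open>f\<close> is
      \<open>fact k\<close>, \<open>s\<close> is \<open>k + 1\<close> and \<open>y\<close> is
      \<open>x + n\<close>.\<close>
    have alg: "P * y / (s * f) * (Q * (c + s)) * g = P * y / (s * f) * (c * Q) * g + y * (P / f * Q * g)"
      if "s \<noteq> 0" "f \<noteq> 0" for P Q y s f g :: complex
      using that by (simp add: field_simps)
    have "c + 1 + of_nat k = c + of_nat (Suc k)" "x + of_nat j + of_nat k = x + of_nat n"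
      by (simp_all add: n)
    then have "pochhammer (x + of_nat j) (Suc n - j) = pochhammer (x + of_nat j) k * (x + of_nat n)"
      "pochhammer (c + 1) (Suc n - j) = pochhammer (c + 1) k * (c + of_nat (Suc k))"
      "fact (Suc n - j) = (of_nat (Suc k) * fact k :: complex)" "n - j = k"
      by (simp_all only: n diff_add_inverse Suc_diff_le le_add1 pochhammer_Suc fact_Suc)
    moreover have "pochhammer c (Suc n - j) = c * pochhammer (c + 1) k"
      by (simp only: n diff_add_inverse Suc_diff_le le_add1 pochhammer_rec)
    ultimately show ?thesis
      using alg[of "of_nat (Suc k)" "fact k"] by (simp only: of_nat_eq_0_iff fact_nonzero nat.distinct not_False_eq_True)
  qed
  show ?thesis
    unfolding norlund_step_def sum.atMost_Suc sum_distrib_left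
    by (subst sum.cong[OF refl *]) (simp_all add: sum.distrib del: times_divide_eq_left times_divide_eq_right)
qed

text \<open>For \<open>x = N + 1\<close> the factor \<open>pochhammer (x + j) (n - j)\<close> is
  \<open>fact (N + n) / fact (N + j)\<close>, so the step amounts to a Cauchy product with
  \<open>bin_fps (e - e')\<close>.\<close>

lemma shifted_fps_change_exponent:
  "shifted_fps N \<gamma> * bin_fps e =
     shifted_fps N (norlund_step (of_nat N + 1) (e' - e) \<gamma>) * bin_fps e'"
proof -
  have "Abs_fps (\<lambda>n. norlund_step (of_nat N + 1) (e' - e) \<gamma> n / fact (N + n))
     = Abs_fps (\<lambda>n. \<gamma> n / fact (N + n)) * bin_fps (e - e')"
  proof (rule fps_ext)
    fix n
    have *: "pochhammer (of_nat N + 1 + of_nat j) (n - j) = (fact (N + n) / fact (N + j) :: complex)"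
      if j: "j \<le> n" for j
    proof -
      obtain k where n: "n = j + k" using le_Suc_ex[OF j] by blast
      have "fact (N + j + k) = fact (N + j) * (pochhammer (of_nat (N + j) + 1) k :: complex)"
        using pochhammer_product'[of "1::complex" "N + j" k] by (simp add: pochhammer_fact add_ac)
      then show ?thesis by (simp add: n add_ac)
    qed
    show "Abs_fps (\<lambda>n. norlund_step (of_nat N + 1) (e' - e) \<gamma> n / fact (N + n)) $ n
        = (Abs_fps (\<lambda>n. \<gamma> n / fact (N + n)) * bin_fps (e - e')) $ n"
      by (auto simp: norlund_step_def fps_mult_nth bin_fps_def sum_divide_distrib atLeast0AtMost *
            intro!: sum.cong)
  qed
  then show ?thesis
    using bin_fps_add[of "e - e'" e'] by (simp add: shifted_fps_def mult.assoc)
qed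

text \<open>The largest number comes first: a longer block gets its new number at the head of the
  list, where \<open>moment_fps_Cons_shifted\<close> acts.\<close>

fun block :: "complex \<Rightarrow> nat \<Rightarrow> complex list" where
  "block c 0 = []"
| "block c (Suc k) = (c + of_nat k) # block c k"

text \<open>The change of exponent is the case \<open>k = 0\<close>. Each new number
  \<open>e' + k\<close> raises \<open>c\<close> by one, and its offset \<open>k\<close> cancels the
  growth of \<open>N + k\<close>, so that \<open>x = N + 1\<close> persists.\<close>

lemma moment_fps_block_append:
  assumes "moment_fps cs = shifted_fps N \<gamma> * bin_fps e" "cs \<noteq> []"
  shows "moment_fps (block e' k @ cs) =
    shifted_fps (N + k) (norlund_step (of_nat N + 1) (e' + of_nat k - e) \<gamma>) * bin_fps e'"
proof (induction k)
  case 0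
  then show ?case using assms shifted_fps_change_exponent by simp
next
  case (Suc k)
  show ?case
    using moment_fps_Cons_shifted[OF Suc, of "norlund_step (of_nat N + 1) (e' + of_nat (Suc k) - e) \<gamma>" "of_nat k"]
      assms(2) norlund_step_Suc[of "of_nat N + 1" "e' + of_nat k - e" \<gamma>]
    by (simp add: algebra_simps)
qed

text \<open>The case \<open>p = 1\<close>. The factor in the recursion of
  \<open>moment_fps_Cons_shifted\<close> is now \<open>n\<close>, which vanishes at the only index
  where the sequence does not.\<close>

lemma moment_fps_block:
  "moment_fps (block e (Suc k)) = shifted_fps k (\<lambda>n. of_bool (n = 0)) * bin_fps e"
proof (induction k)
  case 0
  have "shifted_fps 0 (\<lambda>n. of_bool (n = 0)) = 1"
    by (rule fps_ext) (simp add: shifted_fps_nth)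
  then show ?case by (simp add: moment_fps_singleton)
next
  case (Suc k)
  show ?case
    by (subst block.simps(2), rule moment_fps_Cons_shifted[OF Suc]) auto
qed

fun roots :: "(nat \<Rightarrow> complex) \<Rightarrow> (nat \<Rightarrow> nat) \<Rightarrow> nat \<Rightarrow> complex list" where
  "roots a m 0 = []"
| "roots a m (Suc p) = block (a (Suc p)) (m (Suc p)) @ roots a m p"

text \<open>
  Index shift: \<open>norlund a b q\<close> is the coefficient sequence with both indices
  \<open>p = q + 1\<close>. The multiple sum over \<open>j\<^sub>1 \<le> j\<^sub>2 \<le> \<dots>\<close> is evaluated one index at a time.
\<close>

fun norlund :: "(nat \<Rightarrow> complex) \<Rightarrow> (nat \<Rightarrow> complex) \<Rightarrow> nat \<Rightarrow> nat \<Rightarrow> complex" where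
  "norlund a b 0 = (\<lambda>n. of_bool (n = 0))"
| "norlund a b (Suc q) = norlund_step (psi a b (Suc q)) (b (Suc (Suc q)) - a (Suc q)) (norlund a b q)"

text \<open>If \<open>N + 1\<close> is the sum of the \<open>m i\<close> so far, then
  \<open>x = N + 1\<close> is \<open>psi\<close>, and the change of exponent plus the length of the
  new block is the difference \<open>b - a\<close> in the recursion of
  \<open>norlund\<close>.\<close>

lemma moment_fps_roots:
  assumes "\<And>i. i \<in> {1..Suc q} \<Longrightarrow> m i > 0 \<and> b i = a i + of_nat (m i)"
  shows "roots a m (Suc q) \<noteq> [] \<and> moment_fps (roots a m (Suc q)) =
     shifted_fps ((\<Sum>i=1..Suc q. m i) - 1) (norlund a b q) * bin_fps (a (Suc q))"
  using assms
proof (induction q)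
  case 0
  then obtain k where "m (Suc 0) = Suc k" by (metis gr0_implies_Suc atLeastAtMost_singleton One_nat_def singletonI)
  then show ?case using moment_fps_block[of "a (Suc 0)" k] by simp
next
  case (Suc q)
  define M where "M = (\<Sum>i=1..Suc q. m i)"
  have "m 1 > 0" using Suc.prems by simp
  then have "M > 0" unfolding M_def by (metis One_nat_def finite_atLeastAtMost atLeastAtMost_iff gr0I le_refl not_less_eq_eq sum_eq_0_iff zero_le le_SucI Suc_le_mono)
  have psi: "psi a b (Suc q) = of_nat M"
    unfolding psi_def M_def of_nat_sum using Suc.prems by (intro sum.cong) auto
  have IH: "roots a m (Suc q) \<noteq> []" "moment_fps (roots a m (Suc q)) =
     shifted_fps (M - 1) (norlund a b q) * bin_fps (a (Suc q))"
    using Suc unfolding M_def by auto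
  have b: "b (Suc (Suc q)) = a (Suc (Suc q)) + of_nat (m (Suc (Suc q)))"
    using Suc.prems by simp
  have "(\<Sum>i=1..Suc (Suc q). m i) = M + m (Suc (Suc q))"
    by (simp add: M_def)
  then have "M - 1 + m (Suc (Suc q)) = (\<Sum>i=1..Suc (Suc q). m i) - 1"
    using \<open>M > 0\<close> by linarith
  then show ?case
    using moment_fps_block_append[OF IH(2,1), of "a (Suc (Suc q))" "m (Suc (Suc q))"] IH(1) \<open>M > 0\<close>
    by (simp add: psi b of_nat_diff del: sum.cl_ivl_Suc)
qed

section \<open>Closed forms of the first four coefficients\<close>

lemma norlund_0: "norlund a b q 0 = 1"
  by (induction q) simp_all

lemma norlund_1: "norlund a b q 1 = (\<Sum>m=1..q. (b (m+1) - a m) * psi a b m)"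
  by (induction q) (simp_all add: norlund_step_def norlund_0)

text \<open>Covers a range that starts beyond \<open>Suc q\<close>, where both sums are empty; in
  the applications an empty inner sum then makes \<open>f (Suc q)\<close> zero.\<close>

lemma sum_atLeast_Suc_of_zero:
  fixes f :: "nat \<Rightarrow> 'a :: comm_monoid_add"
  assumes "Suc q < l \<Longrightarrow> f (Suc q) = 0"
  shows "sum f {l..Suc q} = sum f {l..q} + f (Suc q)"
  using assms by simp

text \<open>The terms \<open>j = 2, 1, 0\<close> of the last step are the old value, a multiple of
  \<open>norlund a b q 1\<close>, and the new summand of the first sum.\<close>

lemma norlund_2:
  "norlund a b q 2 =
      1/2 * (\<Sum>m=1..q. pochhammer (b (m+1) - a m) 2 * pochhammer (psi a b m) 2)
      + (\<Sum>k=2..q. (b (k+1) - a k) * (psi a b k + 1) *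
          (\<Sum>m=1..k-1. (b (m+1) - a m) * psi a b m))"
proof (induction q)
  case (Suc q)
  let ?f = "\<lambda>k. (b (k+1) - a k) * (psi a b k + 1) * (\<Sum>m=1..k-1. (b (m+1) - a m) * psi a b m)"
  have "norlund a b (Suc q) 2 = norlund a b q 2
    + (b (Suc q + 1) - a (Suc q)) * (psi a b (Suc q) + 1) * norlund a b q 1
    + 1/2 * (pochhammer (b (Suc q + 1) - a (Suc q)) 2 * pochhammer (psi a b (Suc q)) 2)"
    by (simp add: norlund_step_def numeral_2_eq_2 norlund_0 pochhammer_Suc)
  then have 1: "norlund a b (Suc q) 2 = norlund a b q 2
    + (b (Suc q + 1) - a (Suc q)) * (psi a b (Suc q) + 1) * (\<Sum>m=1..Suc q-1. (b (m+1) - a m) * psi a b m)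
    + 1/2 * (pochhammer (b (Suc q + 1) - a (Suc q)) 2 * pochhammer (psi a b (Suc q)) 2)"
    by (simp only: norlund_1 diff_Suc_1)
  have 2: "(\<Sum>m=1..Suc q. pochhammer (b (m+1) - a m) 2 * pochhammer (psi a b m) 2)
     = (\<Sum>m=1..q. pochhammer (b (m+1) - a m) 2 * pochhammer (psi a b m) 2)
      + pochhammer (b (Suc q + 1) - a (Suc q)) 2 * pochhammer (psi a b (Suc q)) 2"
    by simp
  have 3: "sum ?f {2..Suc q} = sum ?f {2..q} + ?f (Suc q)"
    by (rule sum_atLeast_Suc_of_zero) simp
  \<comment> \<open>The sums enter as opaque variables, so that the arithmetic does not expand
    them.\<close>
  have combine: "X2' = 1/2 * s1' + s2'"
    if "X2 = 1/2 * s1 + s2" "X2' = X2 + u + 1/2 * v" "s1' = s1 + v" "s2' = s2 + u"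
    for X2 X2' s1 s2 s1' s2' u v :: complex
    using that by (simp add: algebra_simps)
  show ?case
    by (rule combine[OF Suc 1 2 3])
qed simp

text \<open>As before with \<open>j = 3, 2, 1, 0\<close>; the term \<open>j = 2\<close> contains
  \<open>norlund a b q 2\<close>, whose two parts extend the second and the fourth sum.\<close>

lemma norlund_3:
  "norlund a b q 3 =
      1/6 * (\<Sum>m=1..q. pochhammer (b (m+1) - a m) 3 * pochhammer (psi a b m) 3)
      + 1/2 * (\<Sum>k=2..q. (b (k+1) - a k) * (psi a b k + 2) *
          (\<Sum>m=1..k-1. pochhammer (b (m+1) - a m) 2 * pochhammer (psi a b m) 2))
      + 1/2 * (\<Sum>k=2..q. pochhammer (psi a b k + 1) 2 * pochhammer (b (k+1) - a k) 2 *
          (\<Sum>m=1..k-1. (b (m+1) - a m) * psi a b m))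
      + (\<Sum>n=3..q. (b (n+1) - a n) * (psi a b n + 2) *
          (\<Sum>k=2..n-1. (b (k+1) - a k) * (psi a b k + 1) *
            (\<Sum>m=1..k-1. (b (m+1) - a m) * psi a b m)))"
proof (induction q)
  case (Suc q)
  let ?f1 = "\<lambda>k. (b (k+1) - a k) * (psi a b k + 2) *
          (\<Sum>m=1..k-1. pochhammer (b (m+1) - a m) 2 * pochhammer (psi a b m) 2)"
  let ?f2 = "\<lambda>k. pochhammer (psi a b k + 1) 2 * pochhammer (b (k+1) - a k) 2 *
          (\<Sum>m=1..k-1. (b (m+1) - a m) * psi a b m)"
  let ?f3 = "\<lambda>n. (b (n+1) - a n) * (psi a b n + 2) *
          (\<Sum>k=2..n-1. (b (k+1) - a k) * (psi a b k + 1) *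
            (\<Sum>m=1..k-1. (b (m+1) - a m) * psi a b m))"
  have "norlund a b (Suc q) 3 = norlund a b q 3
    + (b (Suc q + 1) - a (Suc q)) * (psi a b (Suc q) + 2) * norlund a b q 2
    + 1/2 * (pochhammer (psi a b (Suc q) + 1) 2 * pochhammer (b (Suc q + 1) - a (Suc q)) 2 * norlund a b q 1)
    + 1/6 * (pochhammer (b (Suc q + 1) - a (Suc q)) 3 * pochhammer (psi a b (Suc q)) 3)"
    by (simp add: norlund_step_def numeral_3_eq_3 numeral_2_eq_2 norlund_0 pochhammer_Suc add_ac)
  then have 1: "norlund a b (Suc q) 3 = norlund a b q 3
    + (b (Suc q + 1) - a (Suc q)) * (psi a b (Suc q) + 2) * norlund a b (Suc q - 1) 2
    + 1/2 * (pochhammer (psi a b (Suc q) + 1) 2 * pochhammer (b (Suc q + 1) - a (Suc q)) 2 *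
        (\<Sum>m=1..Suc q-1. (b (m+1) - a m) * psi a b m))
    + 1/6 * (pochhammer (b (Suc q + 1) - a (Suc q)) 3 * pochhammer (psi a b (Suc q)) 3)"
    by (simp only: norlund_1 diff_Suc_1)
  have 2: "(\<Sum>m=1..Suc q. pochhammer (b (m+1) - a m) 3 * pochhammer (psi a b m) 3)
     = (\<Sum>m=1..q. pochhammer (b (m+1) - a m) 3 * pochhammer (psi a b m) 3)
      + pochhammer (b (Suc q + 1) - a (Suc q)) 3 * pochhammer (psi a b (Suc q)) 3"
    by simp
  have 3: "sum ?f1 {2..Suc q} = sum ?f1 {2..q} + ?f1 (Suc q)"
    by (rule sum_atLeast_Suc_of_zero) simp
  have 4: "sum ?f2 {2..Suc q} = sum ?f2 {2..q} + ?f2 (Suc q)"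
    by (rule sum_atLeast_Suc_of_zero) simp
  have 5: "sum ?f3 {3..Suc q} = sum ?f3 {3..q} + ?f3 (Suc q)"
    by (rule sum_atLeast_Suc_of_zero) simp
  have combine: "X3' = 1/6 * s1' + 1/2 * s2' + 1/2 * s3' + s4'"
    if "X3 = 1/6 * s1 + 1/2 * s2 + 1/2 * s3 + s4" "X2 = 1/2 * t + d"
      "X3' = X3 + u * X2 + 1/2 * v + 1/6 * w"
      "s1' = s1 + w" "s2' = s2 + u * t" "s3' = s3 + v" "s4' = s4 + u * d"
    for X2 X3 X3' s1 s2 s3 s4 s1' s2' s3' s4' t d u v w :: complex
    using that by (simp add: algebra_simps add_divide_distrib)
  show ?case
    by (rule combine[OF Suc norlund_2 1 2 3 4 5])
qed simp

section \<open>Contour integrals of rational integrands\<close>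

definition root_prod :: "complex list \<Rightarrow> complex \<Rightarrow> complex" where
  "root_prod cs s = (\<Prod>c\<leftarrow>cs. s + c)"

lemma root_prod_simps [simp]:
  "root_prod [] s = 1"
  "root_prod (c # cs) s = (s + c) * root_prod cs s"
  "root_prod (cs @ ds) s = root_prod cs s * root_prod ds s"
  by (simp_all add: root_prod_def)

lemma root_prod_eq_0_iff: "root_prod cs s = 0 \<longleftrightarrow> s \<in> uminus ` set cs"
  by (induction cs) (auto simp: add_eq_0_iff)

lemma root_prod_holomorphic [holomorphic_intros]: "root_prod cs holomorphic_on A"
  by (induction cs) (auto simp: root_prod_def[abs_def] intro!: holomorphic_intros)

lemma norm_root_prod_ge:
  assumes "\<rho> \<ge> 0" "\<And>c. c \<in> set cs \<Longrightarrow> \<rho> \<le> norm (s + c)"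
  shows "\<rho> ^ length cs \<le> norm (root_prod cs s)"
  using assms by (induction cs) (auto simp: norm_mult intro!: mult_mono)

lemma holomorphic_divide_root_prod:
  assumes "f holomorphic_on UNIV"
  shows "(\<lambda>s. f s / root_prod cs s) holomorphic_on UNIV - uminus ` set cs"
proof (rule holomorphic_on_divide)
  show "f holomorphic_on UNIV - uminus ` set cs"
    using assms by (rule holomorphic_on_subset) simp
qed (auto simp: root_prod_eq_0_iff intro!: holomorphic_intros)

lemma open_avoid_roots: "open (UNIV - uminus ` set (cs :: complex list))"
  by (intro open_Diff open_UNIV finite_imp_closed) simp

lemma integrable_divide_root_prod:
  assumes "f holomorphic_on UNIV" "valid_path g" "path_image g \<inter> uminus ` set cs = {}"
  shows "(\<lambda>s. f s / root_prod cs s) contour_integrable_on g"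
  by (rule contour_integrable_holomorphic_simple[OF holomorphic_divide_root_prod open_avoid_roots])
    (use assms in auto)

text \<open>By the residue theorem both sides are \<open>2 \<pi> \<i>\<close> times the same sum of
  residues.\<close>

lemma loop_independence:
  assumes f: "f holomorphic_on UNIV"
    and g: "valid_path g" "pathfinish g = pathstart g" "\<And>c. c \<in> set cs \<Longrightarrow> - c \<notin> path_image g"
      "\<And>c. c \<in> set cs \<Longrightarrow> winding_number g (- c) = 1"
    and h: "valid_path h" "pathfinish h = pathstart h" "\<And>c. c \<in> set cs \<Longrightarrow> - c \<notin> path_image h"
      "\<And>c. c \<in> set cs \<Longrightarrow> winding_number h (- c) = 1"
  shows "contour_integral g (\<lambda>s. f s / root_prod cs s) = contour_integral h (\<lambda>s. f s / root_prod cs s)"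
proof -
  have *: "contour_integral k (\<lambda>s. f s / root_prod cs s)
      = 2 * pi * \<i> * (\<Sum>p\<in>uminus ` set cs. residue (\<lambda>s. f s / root_prod cs s) p)"
    if k: "valid_path k" "pathfinish k = pathstart k" "\<And>c. c \<in> set cs \<Longrightarrow> - c \<notin> path_image k"
      "\<And>c. c \<in> set cs \<Longrightarrow> winding_number k (- c) = 1" for k
  proof -
    have "contour_integral k (\<lambda>s. f s / root_prod cs s)
      = 2 * pi * \<i> * (\<Sum>p\<in>uminus ` set cs. winding_number k p * residue (\<lambda>s. f s / root_prod cs s) p)"
      by (rule Residue_theorem[OF open_UNIV connected_UNIV _ holomorphic_divide_root_prod[OF f] k(1,2)])
        (use k(3) in auto)
    also have "(\<Sum>p\<in>uminus ` set cs. winding_number k p * residue (\<lambda>s. f s / root_prod cs s) p)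
      = (\<Sum>p\<in>uminus ` set cs. residue (\<lambda>s. f s / root_prod cs s) p)"
      by (intro sum.cong) (use k(4) in auto)
    finally show ?thesis .
  qed
  show ?thesis
    using *[OF g] *[OF h] by simp
qed

text \<open>One root is Cauchy's integral formula. With two or more, the integral does not depend on
  the radius, while the integrand decays at least quadratically, so the integral is zero.\<close>

lemma circle_integral_inverse_root_prod:
  assumes R: "\<And>c. c \<in> set cs \<Longrightarrow> norm c < R" "R > 0" and cs: "cs \<noteq> []"
  shows "contour_integral (circlepath 0 R) (\<lambda>s. 1 / root_prod cs s)
     = 2 * pi * \<i> * of_bool (length cs = 1)"
proof (cases "length cs = 1")
  case True
  then obtain c where c: "cs = [c]" by (auto simp: length_Suc_conv)
  have "((\<lambda>u. 1 / (u - (- c))) has_contour_integral 2 * complex_of_real pi * \<i> * 1) (circlepath 0 R)"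
    by (rule Cauchy_integral_circlepath_simple) (use R c in auto)
  from contour_integral_unique[OF this] show ?thesis
    by (simp add: c)
next
  case False
  let ?I = "contour_integral (circlepath 0 R) (\<lambda>s. 1 / root_prod cs s)"
  have "norm ?I \<le> 4 * pi / \<rho>" if \<rho>: "\<rho> \<ge> R + 1" for \<rho>
  proof -
    \<comment> \<open>This circle has distance at least \<rho> from the points \<open>- c\<close>;
      moreover \<open>\<rho> \<ge> R + 1\<close> gives \<open>\<rho> \<ge> 1\<close> and
      \<open>R + \<rho> \<le> 2 * \<rho>\<close>.\<close>
    let ?R = "R + \<rho>"
    have outside: "norm c < ?R" "norm c < R" if "c \<in> set cs" for c using R(1)[OF that] \<rho> R(2) by auto
    have hol: "(\<lambda>s. 1) holomorphic_on (UNIV :: complex set)" by simp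
    have img: "- c \<notin> path_image (circlepath 0 r)" and wind: "winding_number (circlepath 0 r) (- c) = 1"
      if "norm c < r" for c and r
    proof -
      have "r > 0" using that norm_ge_zero[of c] by linarith
      then show "- c \<notin> path_image (circlepath 0 r)"
        using that by (auto simp: path_image_circlepath_nonneg)
      show "winding_number (circlepath 0 r) (- c) = 1"
        using that by (intro winding_number_circlepath) simp
    qed
    have eq: "?I = contour_integral (circlepath 0 ?R) (\<lambda>s. 1 / root_prod cs s)"
    proof (rule loop_independence[OF hol])
      fix c assume "c \<in> set cs"
      note c = outside[OF this]
      show "- c \<notin> path_image (circlepath 0 R)" "winding_number (circlepath 0 R) (- c) = 1"
        "- c \<notin> path_image (circlepath 0 ?R)" "winding_number (circlepath 0 ?R) (- c) = 1"
        by (rule img[OF c(2)] wind[OF c(2)] img[OF c(1)] wind[OF c(1)])+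
    qed auto
    have int: "(\<lambda>s. 1 / root_prod cs s) contour_integrable_on circlepath 0 ?R"
      by (rule integrable_divide_root_prod[OF hol valid_path_circlepath]) (use img outside(1) in blast)
    have "norm ?I \<le> (1 / \<rho>\<^sup>2) * (2 * pi * ?R)"
      unfolding eq
    proof (rule has_contour_integral_bound_circlepath[OF has_contour_integral_integral[OF int]])
      fix x :: complex assume x: "norm (x - 0) = ?R"
      have "\<rho> ^ length cs \<le> norm (root_prod cs x)"
      proof (rule norm_root_prod_ge)
        fix c assume "c \<in> set cs"
        then show "\<rho> \<le> norm (x + c)"
          using outside(2)[of c] x norm_diff_ineq[of x c] by auto
      qed (use \<rho> R(2) in auto)
      moreover have "length cs \<ge> 2"
        using False cs by (cases cs) (auto simp: Suc_le_eq)
      then have "\<rho>\<^sup>2 \<le> \<rho> ^ length cs"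
        by (intro power_increasing) (use \<rho> R(2) in auto)
      ultimately have "\<rho>\<^sup>2 \<le> norm (root_prod cs x)" by simp
      then show "norm (1 / root_prod cs x) \<le> 1 / \<rho>\<^sup>2"
        using \<rho> R(2) by (simp add: norm_divide frac_le)
    qed (use \<rho> R(2) in auto)
    also have "\<dots> \<le> (1 / \<rho>\<^sup>2) * (2 * pi * (2 * \<rho>))"
      by (intro mult_left_mono) (use \<rho> R(2) in auto)
    also have "\<dots> = 4 * pi / \<rho>"
      by (simp add: power2_eq_square)
    finally show ?thesis .
  qed
  note bound = this
  have "norm ?I = 0"
  proof (rule ccontr)
    assume nz: "norm ?I \<noteq> 0"
    define \<rho> where "\<rho> = max (R + 1) (4 * pi / norm ?I + 1)"
    have \<rho>: "\<rho> \<ge> R + 1" "\<rho> > 4 * pi / norm ?I" "\<rho> > 0" using R(2) by (auto simp: \<rho>_def)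
    have "norm ?I > 0" using nz by simp
    then have "4 * pi < \<rho> * norm ?I" using \<rho>(2) by (simp add: pos_divide_less_eq)
    moreover have "norm ?I * \<rho> \<le> 4 * pi"
      using bound[OF \<rho>(1)] \<rho>(3) by (simp add: pos_le_divide_eq)
    ultimately show False by (simp add: mult.commute)
  qed
  then show ?thesis using False by simp
qed

lemma pochhammer_holomorphic: "(\<lambda>s. pochhammer s n) holomorphic_on A"
  by (auto simp: pochhammer_prod intro!: holomorphic_intros)

text \<open>Induction along \<open>moment\<close>: an empty list leaves an entire integrand,
  \<open>n = 0\<close> is the integral above, and splitting \<open>pochhammer s (Suc n)\<close>
  gives the recursive case.\<close>

lemma circle_integral_pochhammer:
  assumes R: "\<And>c. c \<in> set cs \<Longrightarrow> norm c < R" "R > 0"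
  shows "contour_integral (circlepath 0 R) (\<lambda>s. pochhammer s n / root_prod cs s)
     = 2 * pi * \<i> * moment cs n"
  using R(1)
proof (induction cs n rule: moment.induct)
  case (1 n)
  have "((\<lambda>s. pochhammer s n) has_contour_integral 0) (circlepath 0 R)"
    by (rule Cauchy_theorem_disc_simple[of _ 0 "R + 1"])
      (use R(2) in \<open>auto intro!: pochhammer_holomorphic\<close>)
  then show ?case by (simp add: contour_integral_unique)
next
  case (2 c cs)
  then have "contour_integral (circlepath 0 R) (\<lambda>s. 1 / root_prod (c # cs) s) = 2 * pi * \<i> * of_bool (length (c # cs) = 1)"
    by (intro circle_integral_inverse_root_prod R(2)) simp_all
  then show ?case
    by (simp del: root_prod_simps)
next
  case (3 c cs n)
  let ?J = "\<lambda>ds k. contour_integral (circlepath 0 R) (\<lambda>s. pochhammer s k / root_prod ds s)"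
  have avoid: "- d \<notin> path_image (circlepath 0 R)" if "d \<in> set (c # cs)" for d
    using 3(3)[OF that] R(2) by (auto simp: path_image_circlepath_nonneg)
  have int: "(\<lambda>s. pochhammer s k / root_prod ds s) contour_integrable_on circlepath 0 R"
    if "set ds \<subseteq> set (c # cs)" for ds k
    by (rule integrable_divide_root_prod[OF pochhammer_holomorphic valid_path_circlepath]) (use avoid that in blast)
  have "?J (c # cs) (Suc n) = contour_integral (circlepath 0 R)
      (\<lambda>s. pochhammer s n / root_prod cs s + (of_nat n - c) * (pochhammer s n / root_prod (c # cs) s))"
  proof (rule contour_integral_eq)
    fix s assume "s \<in> path_image (circlepath 0 R)"
    then have "s + c \<noteq> 0" using avoid[of c] by (auto simp: add_eq_0_iff2)
    moreover have "pochhammer s (Suc n) = pochhammer s n * (s + c) + (of_nat n - c) * pochhammer s n"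
      by (simp add: pochhammer_Suc algebra_simps)
    ultimately show "pochhammer s (Suc n) / root_prod (c # cs) s =
        pochhammer s n / root_prod cs s + (of_nat n - c) * (pochhammer s n / root_prod (c # cs) s)"
      by (simp add: add_divide_distrib)
  qed
  also have "\<dots> = ?J cs n + (of_nat n - c) * ?J (c # cs) n"
    by (subst contour_integral_add)
      (simp_all only: int[OF set_subset_Cons] contour_integrable_lmul[OF int[OF order.refl]]
          contour_integral_lmul[OF int[OF order.refl]])
  also have "?J cs n = 2 * pi * \<i> * moment cs n"
    by (rule 3(1)) (simp add: 3(3))
  also have "?J (c # cs) n = 2 * pi * \<i> * moment (c # cs) n"
    by (rule 3(2)[OF 3(3)])
  also have "2 * pi * \<i> * moment cs n + (of_nat n - c) * (2 * pi * \<i> * moment (c # cs) n)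
      = 2 * pi * \<i> * moment (c # cs) (Suc n)"
    by (simp add: algebra_simps)
  finally show ?case .
qed

section \<open>Termwise integration of the binomial series\<close>

lemma norm_pochhammer_le: "norm (pochhammer s n) \<le> pochhammer (norm (s :: complex)) n"
  unfolding pochhammer_prod prod_norm[symmetric]
  by (intro prod_mono) (auto intro: order.trans[OF norm_triangle_ineq])

lemma gbinomial_uminus_mult_power:
  fixes s w :: "'a :: field_char_0"
  shows "(- s gchoose n) * (- w) ^ n = pochhammer s n / fact n * w ^ n"
  by (simp add: gbinomial_pochhammer power_minus[of w])

lemma one_minus_powr_sums:
  fixes s w :: complex
  assumes "norm w < 1"
  shows "(\<lambda>n. pochhammer s n / fact n * w ^ n) sums ((1 - w) powr (- s))"
  using gen_binomial_complex[of "- w" "- s"] assms by (simp add: gbinomial_uminus_mult_power)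

lemma circle_integral_powr_sums:
  fixes w :: real
  assumes R: "\<And>c. c \<in> set cs \<Longrightarrow> norm c < R" "R > 0" and w: "0 < w" "w < 1"
  shows "(\<lambda>n. moment cs n / fact n * of_real w ^ n) sums
    (1 / (2 * of_real pi * \<i>) * contour_integral (circlepath 0 R) (\<lambda>s. of_real (1 - w) powr (- s) / root_prod cs s))"
proof -
  let ?S = "sphere (0::complex) R"
  define f where "f n s = pochhammer s n / fact n * of_real w ^ n * (1 / root_prod cs s)" for n s
  have avoid: "?S \<inter> uminus ` set cs = {}"
    using R by force
  have "continuous_on ?S (\<lambda>s. 1 / root_prod cs s)"
    by (rule holomorphic_on_imp_continuous_on, rule holomorphic_on_subset[OF holomorphic_divide_root_prod])
      (use avoid in auto)
  then have "bounded ((\<lambda>s. 1 / root_prod cs s) ` ?S)"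
    by (intro compact_imp_bounded compact_continuous_image) auto
  then obtain K where K: "\<And>s. s \<in> ?S \<Longrightarrow> norm (1 / root_prod cs s) \<le> K"
    unfolding bounded_iff by blast
  have avoid': "path_image (circlepath 0 R) \<inter> uminus ` set cs = {}"
    using avoid R(2) by (simp add: path_image_circlepath_nonneg)
  have int0: "(\<lambda>s. pochhammer s n / root_prod cs s) contour_integrable_on circlepath 0 R" for n
    by (rule integrable_divide_root_prod[OF pochhammer_holomorphic]) (use avoid' in auto)
  have f_eq: "f n = (\<lambda>s. (of_real w ^ n / fact n) * (pochhammer s n / root_prod cs s))" for n
    by (auto simp: f_def field_simps)
  have int: "f n contour_integrable_on circlepath 0 R" for n
    unfolding f_eq by (intro contour_integrable_lmul int0)
  have f_integral: "contour_integral (circlepath 0 R) (f n) = 2 * pi * \<i> * (moment cs n / fact n * of_real w ^ n)" for n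
  proof -
    have "contour_integral (circlepath 0 R) (f n)
        = of_real w ^ n / fact n * contour_integral (circlepath 0 R) (\<lambda>s. pochhammer s n / root_prod cs s)"
      unfolding f_eq by (rule contour_integral_lmul[OF int0])
    also have "\<dots> = of_real w ^ n / fact n * (2 * pi * \<i> * moment cs n)"
      by (subst circle_integral_pochhammer[OF R]) simp_all
    finally show ?thesis by simp
  qed
  \<comment> \<open>With \<open>K\<close> bounding \<open>1 / root_prod cs s\<close> on the circle,
    the majorants form \<open>K\<close> times the binomial series of
    \<open>(1 - w) powr (- R)\<close>.\<close>
  have ul: "uniform_limit ?S (\<lambda>n s. \<Sum>i<n. f i s) (\<lambda>s. \<Sum>i. f i s) sequentially"
  proof (rule Weierstrass_m_test)
    fix n s assume s: "s \<in> ?S"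
    have "norm (f n s) = norm (pochhammer s n) / fact n * w ^ n * norm (1 / root_prod cs s)"
      using w by (simp add: f_def norm_mult norm_divide norm_power)
    also have "\<dots> \<le> pochhammer R n / fact n * w ^ n * K"
      using w s norm_pochhammer_le[of s n] R(2)
      by (intro mult_mono K divide_right_mono)
        (auto intro!: mult_nonneg_nonneg divide_nonneg_nonneg pochhammer_nonneg)
    finally show "norm (f n s) \<le> pochhammer R n / fact n * w ^ n * K" .
  next
    have "summable (\<lambda>n. (- R gchoose n) * (- w) ^ n)"
      using gen_binomial_real[of "- w" "- R"] w by (auto simp: sums_iff)
    then show "summable (\<lambda>n. pochhammer R n / fact n * w ^ n * K)"
      unfolding gbinomial_uminus_mult_power by (rule summable_mult2)
  qed
  have sum_int: "(\<lambda>s. \<Sum>i<n. f i s) contour_integrable_on circlepath 0 R" for n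
    by (intro contour_integrable_sum int finite_lessThan)
  have "(\<lambda>n. contour_integral (circlepath 0 R) (\<lambda>s. \<Sum>i<n. f i s)) \<longlonglongrightarrow>
      contour_integral (circlepath 0 R) (\<lambda>s. \<Sum>i. f i s)"
    by (rule contour_integral_uniform_limit_circlepath(2)[OF _ ul trivial_limit_sequentially R(2)],
        rule always_eventually, rule allI, rule sum_int)
  also have "(\<lambda>n. contour_integral (circlepath 0 R) (\<lambda>s. \<Sum>i<n. f i s))
      = (\<lambda>n. \<Sum>i<n. 2 * pi * \<i> * (moment cs i / fact i * of_real w ^ i))"
  proof
    fix n
    have "contour_integral (circlepath 0 R) (\<lambda>s. \<Sum>i<n. f i s)
        = (\<Sum>i<n. contour_integral (circlepath 0 R) (f i))"
      by (intro contour_integral_sum int finite_lessThan)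
    also have "\<dots> = (\<Sum>i<n. 2 * pi * \<i> * (moment cs i / fact i * of_real w ^ i))"
      by (simp only: f_integral)
    finally show "contour_integral (circlepath 0 R) (\<lambda>s. \<Sum>i<n. f i s)
        = (\<Sum>i<n. 2 * pi * \<i> * (moment cs i / fact i * of_real w ^ i))" .
  qed
  also have "(\<lambda>s. \<Sum>i. f i s) = (\<lambda>s. of_real (1 - w) powr (- s) / root_prod cs s)"
  proof
    fix s
    have "(\<lambda>n. f n s) sums ((1 - of_real w) powr (- s) * (1 / root_prod cs s))"
      unfolding f_def by (intro sums_mult2 one_minus_powr_sums) (use w in simp)
    then show "(\<Sum>i. f i s) = of_real (1 - w) powr (- s) / root_prod cs s"
      by (simp add: sums_iff)
  qed
  finally have "(\<lambda>n. 2 * pi * \<i> * (moment cs n / fact n * of_real w ^ n)) sums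
      contour_integral (circlepath 0 R) (\<lambda>s. of_real (1 - w) powr (- s) / root_prod cs s)"
    by (simp add: sums_def)
  from sums_mult[OF this, of "1 / (2 * of_real pi * \<i>)"] show ?thesis by simp
qed

section \<open>The left loop for integer parameter differences\<close>

lemma set_block: "set (block c k) = (\<lambda>i. c + of_nat i) ` {..<k}"
  by (induction k) (auto simp: lessThan_Suc)

lemma set_roots: "set (roots a m p) = {a i + of_nat k | i k. i \<in> {1..p} \<and> k < m i}"
proof (induction p)
  case (Suc p)
  have "{1..Suc p} = insert (Suc p) {1..p}" by auto
  then show ?case by (auto simp: set_block Suc)
qed auto

lemma root_prod_block: "root_prod (block c k) s = pochhammer (c + s) k"
  by (induction k) (simp_all add: pochhammer_Suc algebra_simps)

text \<open>Each Gamma quotient is \<open>1 / pochhammer (a i + s) (m i)\<close> by the functional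
  equation; away from the poles \<open>rGamma (a i + s)\<close> is nonzero and cancels.\<close>

lemma meijer_integrand_eq:
  assumes "\<And>i. i \<in> {1..p} \<Longrightarrow> b i = a i + of_nat (m i)"
    and "\<And>i. i \<in> {1..p} \<Longrightarrow> a i + s \<notin> \<int>\<^sub>\<le>\<^sub>0"
  shows "meijer_integrand p a b z s = of_real z powr (- s) / root_prod (roots a m p) s"
proof -
  have "(\<Prod>i=1..p. Gamma (a i + s)) * (\<Prod>i=1..p. rGamma (b i + s)) = 1 / root_prod (roots a m p) s"
    using assms
  proof (induction p)
    case (Suc p)
    let ?c = "a (Suc p) + s"
    have b: "b (Suc p) + s = ?c + of_nat (m (Suc p))" using Suc.prems(1) by simp
    have c: "?c \<notin> \<int>\<^sub>\<le>\<^sub>0" using Suc.prems(2) by simp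
    then have "rGamma ?c \<noteq> 0" by (simp add: rGamma_eq_zero_iff)
    then have "Gamma ?c * rGamma (b (Suc p) + s) = 1 / pochhammer ?c (m (Suc p))"
      using pochhammer_rGamma[of ?c "m (Suc p)"] unfolding b by (auto simp: Gamma_def divide_simps)
    then show ?case
      using Suc by (simp add: root_prod_block field_simps)
  qed simp
  then show ?thesis by (simp add: meijer_integrand_def)
qed

lemma powr_at_top_tendsto_0:
  fixes z :: real
  assumes "0 < z" "z < 1"
  shows "((\<lambda>R. z powr R) \<longlongrightarrow> 0) at_top"
proof -
  have "filterlim (\<lambda>R. ln z * R) at_bot at_top"
    by (rule filterlim_tendsto_neg_mult_at_bot[OF tendsto_const _ filterlim_ident]) (use assms in simp)
  from filterlim_compose[OF exp_at_bot this] show ?thesis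
    using assms by (simp add: powr_def mult.commute)
qed

text \<open>The left edge closes the loop to a rectangle around all points \<open>- d\<close>, whose
  integral is that over the circle. The edge contributes at most
  \<open>z powr R * (\<phi>2 - \<phi>1)\<close>, which tends to zero.\<close>

lemma truncated_loop_integral_tendsto:
  fixes z :: real
  assumes z: "0 < z" "z < 1"
    and \<phi>: "\<phi>1 < \<phi>2"
    and inside: "\<And>d. d \<in> set cs \<Longrightarrow> Re (- d) < c \<and> \<phi>1 < Im (- d) \<and> Im (- d) < \<phi>2"
    and R0: "\<And>d. d \<in> set cs \<Longrightarrow> norm d < R0" "R0 > 0"
  shows "((\<lambda>R. contour_integral (truncated_left_loop c \<phi>1 \<phi>2 R) (\<lambda>s. of_real z powr (- s) / root_prod cs s))
    \<longlongrightarrow> contour_integral (circlepath 0 R0) (\<lambda>s. of_real z powr (- s) / root_prod cs s)) at_top"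
proof -
  let ?f = "\<lambda>s. of_real z powr (- s) / root_prod cs s"
  let ?I = "contour_integral (circlepath 0 R0) ?f"
  let ?edge = "\<lambda>R. linepath (Complex (- R) \<phi>2) (Complex (- R) \<phi>1)"
  have hol: "(\<lambda>s. of_real z powr (- s)) holomorphic_on (UNIV :: complex set)"
    using z by (auto intro!: holomorphic_intros)
  \<comment> \<open>This bound on \<open>R\<close> puts the left edge to the left of
    \<open>c\<close> and at distance at least 1 from every \<open>- d\<close>, so that
    \<open>root_prod\<close> has norm at least 1 there.\<close>
  have rect: "contour_integral (truncated_left_loop c \<phi>1 \<phi>2 R) ?f = ?I - contour_integral (?edge R) ?f
      \<and> norm (contour_integral (?edge R) ?f) \<le> z powr R * (\<phi>2 - \<phi>1)"
    if R: "R \<ge> R0 + 1 + \<bar>c\<bar>" for R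
  proof -
    let ?r = "rectpath (Complex (- R) \<phi>1) (Complex c \<phi>2)"
    have box: "- d \<in> box (Complex (- R) \<phi>1) (Complex c \<phi>2)" if "d \<in> set cs" for d
      using inside[OF that] R0(1)[OF that] R abs_Re_le_cmod[of d] by (auto simp: in_box_complex_iff)
    have img: "path_image ?r = cbox (Complex (- R) \<phi>1) (Complex c \<phi>2) - box (Complex (- R) \<phi>1) (Complex c \<phi>2)"
      using \<phi> R R0(2) by (intro path_image_rectpath_cbox_minus_box) auto
    have "contour_integral ?r ?f = ?I"
    proof (rule loop_independence[OF hol])
      fix d assume d: "d \<in> set cs"
      show "- d \<notin> path_image ?r" using box[OF d] img by auto
      show "winding_number ?r (- d) = 1" using box[OF d] by (rule winding_number_rectpath)
      show "- d \<notin> path_image (circlepath 0 R0)"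
        using R0(1)[OF d] R0(2) by (auto simp: path_image_circlepath_nonneg)
      show "winding_number (circlepath 0 R0) (- d) = 1"
        using R0(1)[OF d] by (intro winding_number_circlepath) simp
    qed auto
    moreover
    have imgs: "path_image ?r = path_image (linepath (Complex (- R) \<phi>1) (Complex c \<phi>1)) \<union>
        path_image (linepath (Complex c \<phi>1) (Complex c \<phi>2)) \<union>
        path_image (linepath (Complex c \<phi>2) (Complex (- R) \<phi>2)) \<union> path_image (?edge R)"
      by (simp add: rectpath_def Let_def path_image_join Un_assoc)
    have int: "?f contour_integrable_on linepath x y" if "path_image (linepath x y) \<subseteq> path_image ?r" for x y
      by (rule integrable_divide_root_prod[OF hol]) (use box that img in auto)
    have ints: "?f contour_integrable_on linepath (Complex (- R) \<phi>1) (Complex c \<phi>1)"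
      "?f contour_integrable_on linepath (Complex c \<phi>1) (Complex c \<phi>2)"
      "?f contour_integrable_on linepath (Complex c \<phi>2) (Complex (- R) \<phi>2)"
      "?f contour_integrable_on ?edge R"
      by (rule int, unfold imgs, blast)+
    have "contour_integral ?r ?f = contour_integral (truncated_left_loop c \<phi>1 \<phi>2 R) ?f
        + contour_integral (?edge R) ?f"
      unfolding truncated_left_loop_def rectpath_def Let_def
      using ints by (simp add: contour_integrable_joinI)
    moreover have "norm (contour_integral (?edge R) ?f) \<le> z powr R * norm (Complex (- R) \<phi>1 - Complex (- R) \<phi>2)"
    proof (rule contour_integral_bound_linepath[OF ints(4)])
      fix s assume "s \<in> closed_segment (Complex (- R) \<phi>2) (Complex (- R) \<phi>1)"
      then have s: "Re s = - R" by (auto simp: closed_segment_same_Re)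
      have "1 ^ length cs \<le> norm (root_prod cs s)"
      proof (rule norm_root_prod_ge)
        fix d assume "d \<in> set cs"
        then show "1 \<le> norm (s + d)"
          using R0(1)[of d] abs_Re_le_cmod[of d] abs_Re_le_cmod[of "s + d"] s R by auto
      qed simp
      moreover have "norm (of_real z powr (- s)) = z powr R"
        using z s by (simp add: norm_powr_real_powr)
      ultimately show "norm (?f s) \<le> z powr R"
        using z by (simp add: norm_divide divide_le_eq mult_left_le)
    qed simp
    moreover have "norm (Complex (- R) \<phi>1 - Complex (- R) \<phi>2) = \<phi>2 - \<phi>1"
      using \<phi> by (simp add: cmod_def)
    ultimately show ?thesis by (simp add: algebra_simps)
  qed
  have ev: "\<forall>\<^sub>F R in at_top. R \<ge> R0 + 1 + \<bar>c\<bar>" by (rule eventually_ge_at_top)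
  have "((\<lambda>R. z powr R * (\<phi>2 - \<phi>1)) \<longlongrightarrow> 0) at_top"
    using tendsto_mult_left_zero[OF powr_at_top_tendsto_0[OF z]] .
  then have "((\<lambda>R. contour_integral (?edge R) ?f) \<longlongrightarrow> 0) at_top"
    by (rule Lim_null_comparison[rotated], intro eventually_mono[OF ev]) (use rect in blast)
  then have "((\<lambda>R. ?I - contour_integral (?edge R) ?f) \<longlongrightarrow> ?I) at_top"
    by (rule tendsto_eq_rhs[OF tendsto_diff[OF tendsto_const]]) simp
  moreover have "\<forall>\<^sub>F R in at_top. ?I - contour_integral (?edge R) ?f
      = contour_integral (truncated_left_loop c \<phi>1 \<phi>2 R) ?f"
    by (rule eventually_mono[OF ev]) (simp only: rect)
  ultimately show ?thesis
    by (rule Lim_transform_eventually)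
qed

text \<open>Each pole is level with some \<open>- a i\<close> and not to its right, hence strictly
  inside the strip and left of \<open>c\<close>.\<close>

lemma truncated_left_loop_avoids_poles:
  assumes "admissible_left_loop p a c \<phi>1 \<phi>2" "s \<in> path_image (truncated_left_loop c \<phi>1 \<phi>2 R)" "i \<in> {1..p}"
  shows "a i + s \<notin> \<int>\<^sub>\<le>\<^sub>0"
proof
  assume "a i + s \<in> \<int>\<^sub>\<le>\<^sub>0"
  then obtain n where "a i + s = - of_nat n" by (auto elim!: nonpos_Ints_cases')
  then have "s = - a i - of_nat n" by (simp add: algebra_simps eq_neg_iff_add_eq_0)
  then have "Re s \<le> Re (- a i)" "Im s = Im (- a i)" by auto
  moreover have "Re s = c \<or> Im s = \<phi>1 \<or> Im s = \<phi>2"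
    using assms(2) by (auto simp: truncated_left_loop_def path_image_join closed_segment_same_Re closed_segment_same_Im)
  ultimately show False
    using assms(1,3) unfolding admissible_left_loop_def by force
qed

lemma meijer_G_sums:
  fixes w :: real
  assumes b: "\<And>i. i \<in> {1..p} \<Longrightarrow> b i = a i + of_nat (m i)" and w: "0 < w" "w < 1"
  shows "(\<lambda>n. moment (roots a m p) n / fact n * of_real w ^ n) sums meijer_G p a b (1 - w)"
proof -
  let ?cs = "roots a m p"
  have "bounded (set ?cs \<union> a ` {1..p})"
    by (intro finite_imp_bounded) auto
  \<comment> \<open>\<open>R\<close> also bounds the \<open>a i\<close> themselves, which provides
    the admissible loop below.\<close>
  then obtain R where R: "R > 0" "\<And>d. d \<in> set ?cs \<union> a ` {1..p} \<Longrightarrow> norm d < R"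
    unfolding bounded_pos_less by blast
  let ?V = "1 / (2 * of_real pi * \<i>) * contour_integral (circlepath 0 R) (\<lambda>s. of_real (1 - w) powr (- s) / root_prod ?cs s)"
  let ?P = "\<lambda>v. \<forall>c \<phi>1 \<phi>2. admissible_left_loop p a c \<phi>1 \<phi>2 \<longrightarrow>
     ((\<lambda>R. 1 / (2 * of_real pi * \<i>) *
        contour_integral (truncated_left_loop c \<phi>1 \<phi>2 R) (meijer_integrand p a b (1 - w))) \<longlongrightarrow> v) at_top"
  have V: "?P ?V"
  proof (intro allI impI)
    fix c \<phi>1 \<phi>2 assume adm: "admissible_left_loop p a c \<phi>1 \<phi>2"
    have eq: "contour_integral (truncated_left_loop c \<phi>1 \<phi>2 R) (meijer_integrand p a b (1 - w))
       = contour_integral (truncated_left_loop c \<phi>1 \<phi>2 R) (\<lambda>s. of_real (1 - w) powr (- s) / root_prod ?cs s)" for R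
      using truncated_left_loop_avoids_poles[OF adm] b
      by (intro contour_integral_eq meijer_integrand_eq) auto
    show "((\<lambda>R. 1 / (2 * of_real pi * \<i>) *
        contour_integral (truncated_left_loop c \<phi>1 \<phi>2 R) (meijer_integrand p a b (1 - w))) \<longlongrightarrow> ?V) at_top"
      unfolding eq
    proof (intro tendsto_mult tendsto_const truncated_loop_integral_tendsto)
      fix d assume "d \<in> set ?cs"
      then obtain i k where "i \<in> {1..p}" "d = a i + of_nat k" by (auto simp: set_roots)
      then show "Re (- d) < c \<and> \<phi>1 < Im (- d) \<and> Im (- d) < \<phi>2"
        using adm unfolding admissible_left_loop_def by force
    qed (use w adm R in \<open>auto simp: admissible_left_loop_def\<close>)
  qed
  \<comment> \<open>The definite description needs at least one admissible loop: otherwise its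
    condition would hold vacuously for every value.\<close>
  have "admissible_left_loop p a R (- R) R"
    unfolding admissible_left_loop_def
  proof (intro conjI ballI)
    fix i assume "i \<in> {1..p}"
    then have "norm (a i) < R" using R(2) by auto
    then show "Re (- a i) < R" "- R < Im (- a i)" "Im (- a i) < R"
      using abs_Re_le_cmod[of "a i"] abs_Im_le_cmod[of "a i"] by auto
  qed (use R in auto)
  then have "meijer_G p a b (1 - w) = ?V"
    unfolding meijer_G_def
    by (intro the_equality V) (use V in \<open>blast intro: tendsto_unique[OF trivial_limit_at_top_linorder]\<close>)
  then show ?thesis
    using circle_integral_powr_sums[of ?cs R w] R w by auto
qed

section \<open>Norlund coefficients\<close>

text \<open>The interval accumulates at 0, inside the disc of convergence, so the identity theorem
  applies to the difference.\<close>

lemma fps_eq_if_eval_eq_on_unit_interval: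
  fixes F G :: "complex fps"
  assumes F: "fps_conv_radius F \<ge> 1" and G: "fps_conv_radius G \<ge> 1"
    and eq: "\<And>w::real. 0 < w \<Longrightarrow> w < 1 \<Longrightarrow> eval_fps F (of_real w) = eval_fps G (of_real w)"
  shows "F = G"
proof (rule eval_fps_eqD)
  show "fps_conv_radius F > 0" "fps_conv_radius G > 0"
    using F G by (auto intro: less_le_trans[of 0 1])
  let ?h = "\<lambda>z. eval_fps F z - eval_fps G z"
  let ?U = "complex_of_real ` {0<..<1}"
  have sub: "ball 0 1 \<subseteq> eball 0 (fps_conv_radius F)" "ball 0 1 \<subseteq> eball 0 (fps_conv_radius G)"
    by (auto simp: in_eball_iff intro!: less_le_trans[OF _ F] less_le_trans[OF _ G])
  have "(0::complex) islimpt ?U"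
  proof (rule islimptI)
    fix T :: "complex set" assume "0 \<in> T" "open T"
    then obtain e where e: "e > 0" "ball 0 e \<subseteq> T" using openE by blast
    define x where "x = min (e / 2) (1 / 2)"
    have "complex_of_real x \<in> ?U" "complex_of_real x \<in> ball 0 e" "complex_of_real x \<noteq> 0"
      using e by (auto simp: x_def min_def)
    then show "\<exists>y\<in>?U. y \<in> T \<and> y \<noteq> 0" using e by blast
  qed
  then have "?h z = 0" if "z \<in> ball 0 1" for z
    by (rule analytic_continuation[rotated 5, where S = "ball 0 1" and f = ?h])
      (use that eq sub in \<open>auto intro!: holomorphic_intros\<close>)
  then have "\<And>z. z \<in> ball 0 1 \<Longrightarrow> eval_fps F z = eval_fps G z" by simp
  then show "\<forall>\<^sub>F z in nhds 0. eval_fps F z = eval_fps G z"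
    by (intro eventually_nhds_in_open[THEN eventually_mono, of "ball 0 1"]) auto
qed

lemma fps_conv_radius_ge_1:
  fixes F :: "complex fps"
  assumes "\<And>w::real. 0 < w \<Longrightarrow> w < 1 \<Longrightarrow> summable (\<lambda>n. F $ n * of_real w ^ n)"
  shows "fps_conv_radius F \<ge> 1"
  unfolding fps_conv_radius_def using assms by (intro conv_radius_geI_ex') auto

lemma bin_fps_sums:
  fixes w :: real
  assumes "0 < w" "w < 1"
  shows "(\<lambda>n. bin_fps e $ n * of_real w ^ n) sums (of_real (1 - w) powr e)"
  using one_minus_powr_sums[of "of_real w" "- e"] assms by (simp add: bin_fps_def)

lemma shifted_fps_pochhammer:
  "shifted_fps N \<gamma> = fps_const (1 / fact N) * fps_X ^ N * Abs_fps (\<lambda>n. \<gamma> n / pochhammer (of_nat (Suc N)) n)"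
proof -
  have "fact (N + n) = fact N * (pochhammer (of_nat (Suc N)) n :: complex)" for n
    using pochhammer_product'[of "1::complex" N n] by (simp add: pochhammer_fact add_ac)
  then have "Abs_fps (\<lambda>n. \<gamma> n / fact (N + n)) =
      fps_const (1 / fact N) * Abs_fps (\<lambda>n. \<gamma> n / pochhammer (of_nat (Suc N)) n)"
    by (simp add: fps_eq_iff)
  then show ?thesis by (simp add: shifted_fps_def mult_ac)
qed

text \<open>Here \<open>psi\<close> is \<open>N + 1\<close>, and for \<open>0 < w < 1\<close> both
  \<open>shifted_fps N (g a b) * bin_fps (a (Suc q))\<close> and \<open>moment_fps\<close> sum to
  \<open>meijer_G\<close> at \<open>1 - w\<close>. Hence the series agree, and the factor
  \<open>bin_fps\<close> cancels.\<close>

lemma norlund_coefficients_integer_steps: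
  assumes g: "norlund_coefficients (Suc q) (Suc q) g"
    and m: "\<And>i. i \<in> {1..Suc q} \<Longrightarrow> m i > 0 \<and> b i = a i + of_nat (m i)"
  shows "g a b = norlund a b q"
proof -
  let ?p = "Suc q"
  let ?cs = "roots a m ?p"
  define M where "M = (\<Sum>i=1..?p. m i)"
  have "m 1 > 0" using m by simp
  moreover have "m 1 \<le> M" unfolding M_def by (intro member_le_sum) auto
  ultimately obtain N where N: "M = Suc N" by (cases M) auto
  have psi: "psi a b ?p = of_nat (Suc N)"
    unfolding psi_def N[symmetric] M_def of_nat_sum using m by (intro sum.cong) auto
  have "- psi a b ?p \<notin> \<nat>"
  proof
    assume "- psi a b ?p \<in> \<nat>"
    then obtain k where "- psi a b ?p = of_nat k" by (auto elim: Nats_cases)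
    then have "of_nat (Suc N + k) = (0::complex)" unfolding psi of_nat_add by (metis add.right_inverse)
    then show False unfolding of_nat_eq_0_iff by simp
  qed
  then have expansion: "summable (\<lambda>n. g a b n / pochhammer (of_nat (Suc N)) n * of_real w ^ n)"
      "meijer_G ?p a b (1 - w) =
         of_real (1 - w) powr a ?p * of_real w powr of_nat N / Gamma (of_nat (Suc N)) *
         (\<Sum>n. g a b n / pochhammer (of_nat (Suc N)) n * of_real w ^ n)"
    if "0 < w" "w < 1" for w :: real
  proof -
    have 1: "0 < 1 - w" "1 - w < 1" "1 - (1 - w) = w" "of_nat (Suc N) - 1 = (of_nat N :: complex)"
      using that by simp_all
    have "summable (\<lambda>n. g a b n / pochhammer (psi a b ?p) n * of_real (1 - (1 - w)) ^ n) \<and>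
         meijer_G ?p a b (1 - w) =
           of_real (1 - w) powr a ?p * of_real (1 - (1 - w)) powr (psi a b ?p - 1) / Gamma (psi a b ?p) *
           (\<Sum>n. g a b n / pochhammer (psi a b ?p) n * of_real (1 - (1 - w)) ^ n)"
      using g[unfolded norlund_coefficients_def] \<open>- psi a b ?p \<notin> \<nat>\<close> 1(1,2) by blast
    then show "summable (\<lambda>n. g a b n / pochhammer (of_nat (Suc N)) n * of_real w ^ n)"
      "meijer_G ?p a b (1 - w) =
         of_real (1 - w) powr a ?p * of_real w powr of_nat N / Gamma (of_nat (Suc N)) *
         (\<Sum>n. g a b n / pochhammer (of_nat (Suc N)) n * of_real w ^ n)"
      unfolding psi 1(3,4) by blast+
  qed
  let ?H = "Abs_fps (\<lambda>n. g a b n / pochhammer (of_nat (Suc N)) n)"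
  let ?F = "moment_fps ?cs" and ?G = "shifted_fps N (g a b) * bin_fps (a ?p)"
  have moments: "(\<lambda>n. ?F $ n * of_real w ^ n) sums meijer_G ?p a b (1 - w)" if "0 < w" "w < 1" for w :: real
    using meijer_G_sums[of ?p b a m w] m that by (simp add: moment_fps_def)
  have F: "fps_conv_radius ?F \<ge> 1"
    by (rule fps_conv_radius_ge_1) (use moments in \<open>auto simp: sums_iff\<close>)
  have H: "fps_conv_radius ?H \<ge> 1"
    by (rule fps_conv_radius_ge_1) (use expansion(1) in simp)
  have B: "fps_conv_radius (bin_fps (a ?p)) \<ge> 1"
    by (rule fps_conv_radius_ge_1) (use bin_fps_sums in \<open>auto simp: sums_iff\<close>)
  have XH: "fps_conv_radius (fps_const (1 / fact N) * fps_X ^ N * ?H) \<ge> 1"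
    by (intro order.trans[OF _ fps_conv_radius_mult] min.boundedI H) auto
  have G: "fps_conv_radius ?G \<ge> 1"
    unfolding shifted_fps_pochhammer
    by (intro order.trans[OF _ fps_conv_radius_mult] min.boundedI XH B)
  have "?F = ?G"
  proof (rule fps_eq_if_eval_eq_on_unit_interval[OF F G])
    fix w :: real assume w: "0 < w" "w < 1"
    have less: "norm (complex_of_real w) < fps_conv_radius f" if "fps_conv_radius f \<ge> 1" for f :: "complex fps"
      using w that by (auto intro: less_le_trans[where y = "1::ereal"])
    have "norm (complex_of_real w) < fps_conv_radius (fps_const (1 / fact N) * fps_X ^ N :: complex fps)"
      by (rule less, intro order.trans[OF _ fps_conv_radius_mult] min.boundedI) auto
    then have "eval_fps ?G (of_real w) = 1 / fact N * of_real w ^ N * eval_fps ?H (of_real w) * eval_fps (bin_fps (a ?p)) (of_real w)"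
      unfolding shifted_fps_pochhammer
      using less[OF H] less[OF B] less[OF XH] by (simp add: eval_fps_mult)
    also have "eval_fps (bin_fps (a ?p)) (of_real w) = of_real (1 - w) powr a ?p"
      using bin_fps_sums[OF w] by (simp add: eval_fps_def sums_iff)
    \<comment> \<open>The prefactors match since \<open>Gamma (N + 1)\<close> is
      \<open>fact N\<close> and \<open>w powr N\<close> is \<open>w ^ N\<close>.\<close>
    also have "1 / fact N * of_real w ^ N * eval_fps ?H (of_real w) * (of_real (1 - w) powr a ?p) = meijer_G ?p a b (1 - w)"
      using Gamma_fact[of N, where ?'a = complex] w
      by (simp add: expansion(2)[OF w] eval_fps_def powr_nat' add_ac)
    also have "\<dots> = eval_fps ?F (of_real w)"
      using moments[OF w] by (simp add: eval_fps_def sums_iff)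
    finally show "eval_fps ?F (of_real w) = eval_fps ?G (of_real w)" ..
  qed
  moreover have "?F = shifted_fps N (norlund a b q) * bin_fps (a ?p)"
    using moment_fps_roots[of q m b a] m N by (simp add: M_def)
  ultimately have "shifted_fps N (g a b) = shifted_fps N (norlund a b q)"
    using bin_fps_nonzero by simp
  then show ?thesis by (rule shifted_fps_inj)
qed

section \<open>Extension to all complex parameters by polynomial dependence\<close>

lemma polynomial_in_params_diff:
  assumes "polynomial_in_params p f" "polynomial_in_params p h"
  shows "polynomial_in_params p (\<lambda>a b. f a b - h a b)"
  using polynomial_in_params.add[OF assms(1) polynomial_in_params.mult[OF polynomial_in_params.const[of p "- 1"] assms(2)]]
  by simp

lemma polynomial_in_params_sum:
  assumes "\<And>i. i \<in> I \<Longrightarrow> polynomial_in_params p (f i)"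
  shows "polynomial_in_params p (\<lambda>a b. \<Sum>i\<in>I. f i a b)"
  using assms
  by (induction I rule: infinite_finite_induct) (auto intro: polynomial_in_params.intros)

lemma polynomial_in_params_pochhammer:
  assumes "polynomial_in_params p f"
  shows "polynomial_in_params p (\<lambda>a b. pochhammer (f a b) n)"
  by (induction n) (auto simp: pochhammer_Suc intro!: polynomial_in_params.intros assms)

text \<open>The bound on \<open>q\<close> reflects that \<open>norlund a b q\<close> involves no
  entry beyond index \<open>q + 1\<close>.\<close>

lemma polynomial_in_params_norlund:
  "q < p \<Longrightarrow> polynomial_in_params p (\<lambda>a b. norlund a b q n)"
proof (induction q arbitrary: n)
  case (Suc q)
  show ?case
    \<comment> \<open>Division by a factorial becomes multiplication by a constant.\<close>
    unfolding norlund.simps norlund_step_def psi_def divide_inverse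
    by (intro polynomial_in_params_sum polynomial_in_params.mult polynomial_in_params_pochhammer
        polynomial_in_params.add polynomial_in_params.const polynomial_in_params_diff
        polynomial_in_params.comp_a polynomial_in_params.comp_b Suc.IH)
      (use Suc.prems in auto)
qed (auto intro: polynomial_in_params.const)

text \<open>Reduces to one variable, where a nonzero polynomial has finitely many roots.\<close>

lemma polynomial_in_params_coordinate:
  "polynomial_in_params p f \<Longrightarrow> \<exists>q. \<forall>t. f a (b(i := t)) = poly q t"
proof (induction rule: polynomial_in_params.induct)
  case (const c)
  show ?case by (rule exI[of _ "[:c:]"]) simp
next
  case (comp_a j)
  show ?case by (rule exI[of _ "[:a j:]"]) simp
next
  case (comp_b j)
  show ?case by (rule exI[of _ "if j = i then [:0, 1:] else [:b j:]"]) simp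
next
  case (add f h)
  then show ?case by (metis poly_add)
next
  case (mult f h)
  then show ?case by (metis poly_mult)
qed

text \<open>With \<open>a\<close> fixed, the entries of \<open>b\<close> are freed one at a time: a
  polynomial in one entry that vanishes at \<open>a i + 1, a i + 2, ...\<close> is zero.\<close>

lemma polynomial_in_params_eqI:
  assumes f: "polynomial_in_params p f" and h: "polynomial_in_params p h"
    and eq: "\<And>b m. (\<And>i. i \<in> {1..p} \<Longrightarrow> m i > 0 \<and> b i = a i + of_nat (m i)) \<Longrightarrow> f a b = h a b"
  shows "f a b = h a b"
proof -
  \<comment> \<open>Entries of \<open>b\<close> up to index \<open>k\<close> are already arbitrary,
    the later ones still exceed those of \<open>a\<close> by positive integers; \<open>k = p\<close>
    is the claim.\<close>
  have "f a b = h a b" if "\<forall>i\<in>{k<..p}. \<exists>m>0. b i = a i + of_nat m" for k b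
    using that
  proof (induction k arbitrary: b)
    case 0
    then obtain m where "\<forall>i\<in>{0<..p}. m i > 0 \<and> b i = a i + of_nat (m i)" by metis
    then show ?case by (intro eq[of m]) auto
  next
    case (Suc k)
    obtain r where r: "\<And>t. f a (b(Suc k := t)) - h a (b(Suc k := t)) = poly r t"
      using polynomial_in_params_coordinate[OF polynomial_in_params_diff[OF f h], of a b "Suc k"] by blast
    have "poly r (a (Suc k) + of_nat (Suc n)) = 0" for n
    proof -
      have "f a (b(Suc k := a (Suc k) + of_nat (Suc n))) = h a (b(Suc k := a (Suc k) + of_nat (Suc n)))"
        by (rule Suc.IH) (use Suc.prems in \<open>auto intro: exI[of _ "Suc n"]\<close>)
      then show ?thesis by (simp flip: r)
    qed
    then have "range (\<lambda>n. a (Suc k) + of_nat (Suc n)) \<subseteq> {t. poly r t = 0}" by blast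
    moreover have "infinite (range (\<lambda>n. a (Suc k) + of_nat (Suc n)))"
      by (rule range_inj_infinite) (simp add: inj_on_def)
    ultimately have "r = 0" using poly_roots_finite finite_subset by blast
    then show ?case using r[of "b (Suc k)"] by simp
  qed
  from this[of p b] show ?thesis by simp
qed

lemma norlund_coefficients_eq:
  assumes "norlund_coefficients (Suc q) (Suc q) g"
  shows "g a b n = norlund a b q n"
proof (rule polynomial_in_params_eqI[where f = "\<lambda>a b. g a b n" and p = "Suc q"])
  show "polynomial_in_params (Suc q) (\<lambda>a b. g a b n)"
    using assms by (simp add: norlund_coefficients_def)
  show "polynomial_in_params (Suc q) (\<lambda>a b. norlund a b q n)"
    by (rule polynomial_in_params_norlund) simp
  show "g a b n = norlund a b q n"
    if "\<And>i. i \<in> {1..Suc q} \<Longrightarrow> m i > 0 \<and> b i = a i + of_nat (m i)" for b m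
    using norlund_coefficients_integer_steps[OF assms that] by simp
qed

theorem theorem3p1:
  fixes p :: nat
    and a b :: "nat \<Rightarrow> complex"
    and g :: "(nat \<Rightarrow> complex) \<Rightarrow> (nat \<Rightarrow> complex) \<Rightarrow> nat \<Rightarrow> complex"
  assumes "p \<ge> 1"
    and "norlund_coefficients p p g"
  shows "g a b 0 = 1
      \<and> g a b 1 = (\<Sum>m=1..p-1. (b (m+1) - a m) * psi a b m)
      \<and> g a b 2 =
      1/2 * (\<Sum>m=1..p-1. pochhammer (b (m+1) - a m) 2 * pochhammer (psi a b m) 2)
      + (\<Sum>k=2..p-1. (b (k+1) - a k) * (psi a b k + 1) *
          (\<Sum>m=1..k-1. (b (m+1) - a m) * psi a b m))
      \<and> g a b 3 =
      1/6 * (\<Sum>m=1..p-1. pochhammer (b (m+1) - a m) 3 * pochhammer (psi a b m) 3)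
      + 1/2 * (\<Sum>k=2..p-1. (b (k+1) - a k) * (psi a b k + 2) *
          (\<Sum>m=1..k-1. pochhammer (b (m+1) - a m) 2 * pochhammer (psi a b m) 2))
      + 1/2 * (\<Sum>k=2..p-1. pochhammer (psi a b k + 1) 2 * pochhammer (b (k+1) - a k) 2 *
          (\<Sum>m=1..k-1. (b (m+1) - a m) * psi a b m))
      + (\<Sum>n=3..p-1. (b (n+1) - a n) * (psi a b n + 2) *
          (\<Sum>k=2..n-1. (b (k+1) - a k) * (psi a b k + 1) *
            (\<Sum>m=1..k-1. (b (m+1) - a m) * psi a b m)))"
proof -
  obtain q where p: "p = Suc q"
    using assms(1) by (cases p) auto
  have g: "g a b n = norlund a b q n" for n
    using assms(2) unfolding p by (rule norlund_coefficients_eq)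
  show ?thesis
    unfolding g p diff_Suc_1
    by (intro conjI norlund_0 norlund_1 norlund_2 norlund_3)
qed

end
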